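(* There exist integers $n\ge p\ge1$, a constant $L$ and an $L$-smooth function $f:\mathbb R^{n\times p}\to\mathbb R$, a contractive compressor $\mathcal C$ on $\mathbb R^{n\times p}$, and an initial point $X^0\in\mathbb R^{n\times p}$ such that, for any penalty parameter $\lambda>0$ and any step size $\gamma>0$, the iteration $$g^k=\mathcal C(\nabla f(X^k)),\qquad \tilde\Lambda(X^k;g^k)=\mathrm{skew}(g^k(X^k)^\top)X^k+\lambda X^k\big((X^k)^\top X^k-I_p\big),\qquad X^{k+1}=X^k-\gamma\tilde\Lambda(X^k;g^k)$$ stagnates without converging to a stationary solution: $X^k=X^0$ for all $k\ge0$, while $X^0$ is not a stationary point of the problem $\min f(X)$ subject to $X^\top X=I_p$.
   Context: $\mathrm{skew}(M)=\frac12(M-M^\top)$; $f$ is $L$-smooth if it is differentiable with $\|\nabla f(X)-\nabla f(Y)\|_F\le L\|X-Y\|_F$. A contractive compressor is a (possibly random) map $\mathcal C:\mathbb R^{n\times p}\to\mathbb R^{n\times p}$ for which there is $\alpha\in(0,1]$ with $\mathbb E_{\mathcal C}\|\mathcal C(X)-X\|_F^2\le(1-\alpha)\|X\|_F^2$ for all $X$. A point $X$ is stationary for $\min f(X)$ s.t. $X^\top X=I_p$ if $X^\top X=I_p$ and $\mathrm{skew}(\nabla f(X)X^\top)X=0$. *)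

theory Defs
  imports "HOL-Probability.Probability_Measure" "Jordan_Normal_Form.Matrix"
begin

text \<open>
  The space of real n-by-p matrices is \<^term>\<open>carrier_mat n p :: real mat set\<close>, so that the
  dimensions can be quantified. Functions on this space are total functions on
  \<^typ>\<open>real mat\<close>; only their values on the carrier are ever used.
\<close>

definition fro_inner :: "real mat \<Rightarrow> real mat \<Rightarrow> real" where
  "fro_inner A B = (\<Sum>i<dim_row A. \<Sum>j<dim_col A. A $$ (i, j) * B $$ (i, j))"

definition fro_norm :: "real mat \<Rightarrow> real" where
  "fro_norm A = sqrt (\<Sum>i<dim_row A. \<Sum>j<dim_col A. (A $$ (i, j))\<^sup>2)"

definition skew :: "real mat \<Rightarrow> real mat" where
  "skew M = (1 / 2) \<cdot>\<^sub>m (M - M\<^sup>T)"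

text \<open>
  Frechet differentiability of f at X, with derivative represented by the matrix G through
  the Frobenius inner product.
\<close>

definition has_gradient_at :: "nat \<Rightarrow> nat \<Rightarrow> (real mat \<Rightarrow> real) \<Rightarrow> real mat \<Rightarrow> real mat \<Rightarrow> bool" where
  "has_gradient_at n p f G X \<longleftrightarrow> G \<in> carrier_mat n p \<and>
     (\<forall>\<epsilon>>0. \<exists>\<delta>>0. \<forall>Y\<in>carrier_mat n p. fro_norm (Y - X) < \<delta> \<longrightarrow>
        \<bar>f Y - f X - fro_inner G (Y - X)\<bar> \<le> \<epsilon> * fro_norm (Y - X))"

definition gradient :: "nat \<Rightarrow> nat \<Rightarrow> (real mat \<Rightarrow> real) \<Rightarrow> real mat \<Rightarrow> real mat" where
  "gradient n p f X = (THE G. has_gradient_at n p f G X)"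

definition L_smooth :: "nat \<Rightarrow> nat \<Rightarrow> real \<Rightarrow> (real mat \<Rightarrow> real) \<Rightarrow> bool" where
  "L_smooth n p L f \<longleftrightarrow>
     (\<forall>X\<in>carrier_mat n p. \<exists>G. has_gradient_at n p f G X) \<and>
     (\<forall>X\<in>carrier_mat n p. \<forall>Y\<in>carrier_mat n p.
        fro_norm (gradient n p f X - gradient n p f Y) \<le> L * fro_norm (X - Y))"

text \<open>
  A random map is a family of maps \<^term>\<open>C \<omega>\<close> indexed by the outcomes of a probability
  space; a deterministic map is one that does not depend on the outcome.
\<close>

definition contractive_compressor ::
    "nat \<Rightarrow> nat \<Rightarrow> 'w measure \<Rightarrow> ('w \<Rightarrow> real mat \<Rightarrow> real mat) \<Rightarrow> bool" where
  "contractive_compressor n p M C \<longleftrightarrow> prob_space M \<and>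
     (\<forall>\<omega>\<in>space M. \<forall>X\<in>carrier_mat n p. C \<omega> X \<in> carrier_mat n p) \<and>
     (\<forall>X\<in>carrier_mat n p. \<forall>i<n. \<forall>j<p. (\<lambda>\<omega>. C \<omega> X $$ (i, j)) \<in> borel_measurable M) \<and>
     (\<exists>\<alpha>. 0 < \<alpha> \<and> \<alpha> \<le> 1 \<and>
        (\<forall>X\<in>carrier_mat n p.
           integrable M (\<lambda>\<omega>. (fro_norm (C \<omega> X - X))\<^sup>2) \<and>
           (\<integral>\<omega>. (fro_norm (C \<omega> X - X))\<^sup>2 \<partial>M) \<le> (1 - \<alpha>) * (fro_norm X)\<^sup>2))"

definition stationary :: "nat \<Rightarrow> nat \<Rightarrow> (real mat \<Rightarrow> real) \<Rightarrow> real mat \<Rightarrow> bool" where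
  "stationary n p f X \<longleftrightarrow> X \<in> carrier_mat n p \<and> X\<^sup>T * X = 1\<^sub>m p \<and>
     skew (gradient n p f X * X\<^sup>T) * X = 0\<^sub>m n p"

definition landing_field :: "real \<Rightarrow> real mat \<Rightarrow> real mat \<Rightarrow> real mat" where
  "landing_field lam X g =
     skew (g * X\<^sup>T) * X + lam \<cdot>\<^sub>m (X * (X\<^sup>T * X - 1\<^sub>m (dim_col X)))"

text \<open>\<^term>\<open>\<omega> k\<close> is the outcome drawn by the compressor in iteration k.\<close>

primrec iterate ::
    "nat \<Rightarrow> nat \<Rightarrow> (real mat \<Rightarrow> real) \<Rightarrow> ('w \<Rightarrow> real mat \<Rightarrow> real mat) \<Rightarrow> (nat \<Rightarrow> 'w) \<Rightarrow>
     real \<Rightarrow> real \<Rightarrow> real mat \<Rightarrow> nat \<Rightarrow> real mat" where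
  "iterate n p f C \<omega> lam \<gamma> X0 0 = X0"
| "iterate n p f C \<omega> lam \<gamma> X0 (Suc k) =
     (let X = iterate n p f C \<omega> lam \<gamma> X0 k;
          g = C (\<omega> k) (gradient n p f X)
      in X - \<gamma> \<cdot>\<^sub>m landing_field lam X g)"

text \<open>The gradient is unique, so the definite description above is meaningful.\<close>

lemma fro_inner_self: "fro_inner A A = (fro_norm A)\<^sup>2"
  by (simp add: fro_inner_def fro_norm_def sum_nonneg power2_eq_square)

lemma fro_norm_smult: "fro_norm (t \<cdot>\<^sub>m A) = \<bar>t\<bar> * fro_norm A"
  by (simp add: fro_norm_def power_mult_distrib sum_distrib_left[symmetric] real_sqrt_mult)

lemma fro_inner_smult_right:
  "A \<in> carrier_mat n p \<Longrightarrow> B \<in> carrier_mat n p \<Longrightarrow> fro_inner A (t \<cdot>\<^sub>m B) = t * fro_inner A B"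
  by (auto simp: fro_inner_def sum_distrib_left intro!: sum.cong)

lemma fro_inner_diff_left:
  "A \<in> carrier_mat n p \<Longrightarrow> B \<in> carrier_mat n p \<Longrightarrow>
   fro_inner (A - B) Z = fro_inner A Z - fro_inner B Z"
  by (auto simp: fro_inner_def sum_subtractf[symmetric] algebra_simps intro!: sum.cong)

lemma fro_norm_ge_0: "0 \<le> fro_norm A"
  by (simp add: fro_norm_def sum_nonneg)

lemma fro_norm_eq_0_imp:
  assumes "fro_norm A = 0" "A \<in> carrier_mat n p" shows "A = 0\<^sub>m n p"
proof (rule eq_matI)
  have S: "(\<Sum>i<n. \<Sum>j<p. (A $$ (i, j))\<^sup>2) = 0"
    using assms by (auto simp: fro_norm_def)
  fix i j assume "i < dim_row (0\<^sub>m n p)" "j < dim_col (0\<^sub>m n p)"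
  then have ij: "i < n" "j < p" by auto
  from S have "\<forall>i\<in>{..<n}. (\<Sum>j<p. (A $$ (i, j))\<^sup>2) = 0"
    by (subst (asm) sum_nonneg_eq_0_iff) (auto intro: sum_nonneg)
  then have "(\<Sum>j<p. (A $$ (i, j))\<^sup>2) = 0" using ij by auto
  then have "A $$ (i, j) = 0" using ij by (simp add: sum_nonneg_eq_0_iff)
  then show "A $$ (i, j) = 0\<^sub>m n p $$ (i, j)" using ij by simp
qed (use assms in auto)

lemma has_gradient_at_unique:
  assumes X: "X \<in> carrier_mat n p"
    and G: "has_gradient_at n p f G X" and H: "has_gradient_at n p f H X"
  shows "G = H"
proof -
  have Gc: "G \<in> carrier_mat n p" and Hc: "H \<in> carrier_mat n p"
    using G H by (auto simp: has_gradient_at_def)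
  define D where "D = G - H"
  have Dc: "D \<in> carrier_mat n p" using Gc Hc by (auto simp: D_def)
  have "fro_norm D = 0"
  proof (rule ccontr)
    assume "fro_norm D \<noteq> 0"
    then have pos: "fro_norm D > 0" using fro_norm_ge_0[of D] by linarith
    define e where "e = fro_norm D / 3"
    have e: "e > 0" using pos by (simp add: e_def)
    obtain d1 where d1: "d1 > 0" "\<And>Y. Y \<in> carrier_mat n p \<Longrightarrow> fro_norm (Y - X) < d1 \<Longrightarrow>
        \<bar>f Y - f X - fro_inner G (Y - X)\<bar> \<le> e * fro_norm (Y - X)"
      using G e unfolding has_gradient_at_def by meson
    obtain d2 where d2: "d2 > 0" "\<And>Y. Y \<in> carrier_mat n p \<Longrightarrow> fro_norm (Y - X) < d2 \<Longrightarrow>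
        \<bar>f Y - f X - fro_inner H (Y - X)\<bar> \<le> e * fro_norm (Y - X)"
      using H e unfolding has_gradient_at_def by meson
    define t where "t = min d1 d2 / (2 * fro_norm D)"
    have t: "t > 0" using d1 d2 pos by (simp add: t_def)
    define Y where "Y = X + t \<cdot>\<^sub>m D"
    have Yc: "Y \<in> carrier_mat n p" using X Dc by (simp add: Y_def)
    have YX: "Y - X = t \<cdot>\<^sub>m D" unfolding Y_def using X Dc by (intro eq_matI) auto
    have nYX: "fro_norm (Y - X) = t * fro_norm D" using t by (simp add: YX fro_norm_smult)
    have small: "t * fro_norm D < d1" "t * fro_norm D < d2"
      using d1(1) d2(1) pos by (auto simp: t_def min_def)
    have "\<bar>f Y - f X - fro_inner G (Y - X)\<bar> \<le> e * (t * fro_norm D)"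
      and "\<bar>f Y - f X - fro_inner H (Y - X)\<bar> \<le> e * (t * fro_norm D)"
      using d1(2)[OF Yc] d2(2)[OF Yc] small nYX by auto
    moreover have "fro_inner G (Y - X) - fro_inner H (Y - X) = t * (fro_norm D)\<^sup>2"
      using fro_inner_diff_left[OF Gc Hc, of "Y - X"] fro_inner_smult_right[OF Dc Dc, of t]
      by (simp add: YX D_def[symmetric] fro_inner_self)
    ultimately have "t * (fro_norm D)\<^sup>2 \<le> 2 * (e * (t * fro_norm D))" by linarith
    also have "\<dots> = t * (fro_norm D)\<^sup>2 * (2 / 3)" by (simp add: e_def power2_eq_square)
    finally show False using t pos by (simp add: field_simps)
  qed
  then have "D = 0\<^sub>m n p" using Dc by (rule fro_norm_eq_0_imp)
  show ?thesis
  proof (rule eq_matI)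
    fix i j assume ij: "i < dim_row H" "j < dim_col H"
    then have "D $$ (i, j) = 0" using \<open>D = 0\<^sub>m n p\<close> Hc by auto
    then show "G $$ (i, j) = H $$ (i, j)" using ij by (simp add: D_def)
  qed (use Gc Hc in auto)
qed

lemma gradient_eqI:
  "X \<in> carrier_mat n p \<Longrightarrow> has_gradient_at n p f G X \<Longrightarrow> gradient n p f X = G"
  unfolding gradient_def by (blast intro: has_gradient_at_unique)

end

(* On the unit circle (n = 2, p = 1) the skew part of the landing field vanishes exactly when g
   is parallel to X, and the penalty vanishes as well. At X = (1, 0) the gradient (2, 1) of a
   linear function is not parallel to X, but the compressor that keeps only the entry of largest
   modulus turns it into (2, 0), which is. *)

theory Submission
  imports Defs "HOL-Probability.Giry_Monad"
begin

lemma fro_inner_diff_right: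
  assumes "A \<in> carrier_mat n p" "Y \<in> carrier_mat n p" "X \<in> carrier_mat n p"
  shows "fro_inner A (Y - X) = fro_inner A Y - fro_inner A X"
  using assms by (auto simp: fro_inner_def sum_subtractf[symmetric] algebra_simps intro!: sum.cong)

lemma has_gradient_at_fro_inner:
  assumes "G \<in> carrier_mat n p" "X \<in> carrier_mat n p"
  shows "has_gradient_at n p (fro_inner G) G X"
  unfolding has_gradient_at_def
proof (intro conjI allI impI)
  fix \<epsilon> :: real assume "\<epsilon> > 0"
  then have "\<forall>Y\<in>carrier_mat n p.
      \<bar>fro_inner G Y - fro_inner G X - fro_inner G (Y - X)\<bar> \<le> \<epsilon> * fro_norm (Y - X)"
    using assms by (simp add: fro_inner_diff_right fro_norm_ge_0)
  then show "\<exists>\<delta>>0. \<forall>Y\<in>carrier_mat n p. fro_norm (Y - X) < \<delta> \<longrightarrow>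
      \<bar>fro_inner G Y - fro_inner G X - fro_inner G (Y - X)\<bar> \<le> \<epsilon> * fro_norm (Y - X)"
    \<comment> \<open>The first-order remainder of a linear function is exactly zero, so every
      radius works and 1 is an arbitrary choice.\<close>
    by (intro exI[of _ 1]) auto
qed (use assms in simp)

lemma gradient_fro_inner:
  "G \<in> carrier_mat n p \<Longrightarrow> X \<in> carrier_mat n p \<Longrightarrow> gradient n p (fro_inner G) X = G"
  by (simp add: gradient_eqI has_gradient_at_fro_inner)

text \<open>The gradient of a linear function is the same matrix everywhere, so gradient differences
  vanish and the Lipschitz constant can be 0.\<close>

lemma L_smooth_fro_inner:
  assumes "G \<in> carrier_mat n p"
  shows "L_smooth n p 0 (fro_inner G)"
proof -
  have "fro_norm (G - G) = 0"
    by (simp add: fro_norm_def)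
  then show ?thesis
    using assms by (auto simp: L_smooth_def gradient_fro_inner intro: has_gradient_at_fro_inner)
qed

text \<open>The entries of the Gram matrix of the rows of \<open>X\<close> are inner products of
  rows, so this matrix and its multiples are symmetric.\<close>

lemma skew_smult_self_outer:
  assumes "X \<in> carrier_mat n p"
  shows "skew (c \<cdot>\<^sub>m X * X\<^sup>T) = 0\<^sub>m n n"
proof -
  have "row X i \<bullet> row X j = row X j \<bullet> row X i" for i j
    using assms by (intro comm_scalar_prod[of _ p]) auto
  then have "(c \<cdot>\<^sub>m X * X\<^sup>T)\<^sup>T = c \<cdot>\<^sub>m X * X\<^sup>T"
    using assms by (intro eq_matI) (auto simp: mult_smult_assoc_mat[OF assms, of "X\<^sup>T" n])
  then show ?thesis
    using assms by (auto simp: skew_def intro!: eq_matI)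
qed

text \<open>The two terms vanish separately: the first by symmetry, the penalty because
  \<open>X\<close> is feasible. Hence the value of \<open>lam\<close> is arbitrary.\<close>

lemma landing_field_smult_self:
  assumes X: "X \<in> carrier_mat n p" and orth: "X\<^sup>T * X = 1\<^sub>m p"
  shows "landing_field lam X (c \<cdot>\<^sub>m X) = 0\<^sub>m n p"
proof -
  have "X\<^sup>T * X - 1\<^sub>m (dim_col X) = 0\<^sub>m p p"
    using X by (auto simp: orth)
  then show ?thesis
    using X by (auto simp: landing_field_def skew_smult_self_outer right_mult_zero_mat)
qed

lemma iterate_eq_initial:
  assumes "X0 \<in> carrier_mat n p"
    and "\<And>k. landing_field lam X0 (C (\<omega> k) (gradient n p f X0)) = 0\<^sub>m n p"
  shows "iterate n p f C \<omega> lam \<gamma> X0 k = X0"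
  using assms by (induction k) (auto simp: Let_def intro!: eq_matI)

text \<open>The error of a map that ignores the outcome is constant in the outcome, and the mean of
  a constant over a probability space is that constant. A pointwise bound therefore
  suffices.\<close>

lemma contractive_compressor_deterministic:
  assumes "prob_space M"
    and "\<And>X. X \<in> carrier_mat n p \<Longrightarrow> c X \<in> carrier_mat n p"
    and "0 < \<alpha>" "\<alpha> \<le> 1"
    and "\<And>X. X \<in> carrier_mat n p \<Longrightarrow> (fro_norm (c X - X))\<^sup>2 \<le> (1 - \<alpha>) * (fro_norm X)\<^sup>2"
  shows "contractive_compressor n p M (\<lambda>_. c)"
proof -
  interpret prob_space M by fact
  show ?thesis
    using assms by (auto simp: contractive_compressor_def prob_space)
qed

text \<open>The Top-1 sparsifier. The equality of truth values selects row 0 if its entry dominates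
  and row 1 otherwise; a tie keeps row 0.\<close>

definition top1 :: "real mat \<Rightarrow> real mat" where
  "top1 X = mat 2 1 (\<lambda>(i, j).
     if (i = 0) = (\<bar>X $$ (1, 0)\<bar> \<le> \<bar>X $$ (0, 0)\<bar>) then X $$ (i, j) else 0)"

lemma fro_norm_sq_2_1:
  "X \<in> carrier_mat 2 1 \<Longrightarrow> (fro_norm X)\<^sup>2 = (X $$ (0, 0))\<^sup>2 + (X $$ (1, 0))\<^sup>2"
  by (auto simp: fro_norm_def numeral_2_eq_2)

text \<open>The squared error is the square of the discarded entry. This is the smaller of the two
  squares, hence at most half of their sum.\<close>

lemma top1_contraction:
  assumes X: "X \<in> carrier_mat 2 1"
  shows "(fro_norm (top1 X - X))\<^sup>2 \<le> (1 - 1/2) * (fro_norm X)\<^sup>2"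
proof -
  have D: "top1 X - X \<in> carrier_mat 2 1"
    using X by (intro minus_carrier_mat)
  show ?thesis
  proof (cases "\<bar>X $$ (1, 0)\<bar> \<le> \<bar>X $$ (0, 0)\<bar>")
    case True
    then have "(X $$ (1, 0))\<^sup>2 \<le> (X $$ (0, 0))\<^sup>2"
      by (simp add: abs_le_square_iff)
    with True X show ?thesis
      unfolding fro_norm_sq_2_1[OF D] fro_norm_sq_2_1[OF X] by (simp add: top1_def)
  next
    case False
    then have "(X $$ (0, 0))\<^sup>2 \<le> (X $$ (1, 0))\<^sup>2"
      by (simp add: abs_le_square_iff[symmetric])
    with False X show ?thesis
      unfolding fro_norm_sq_2_1[OF D] fro_norm_sq_2_1[OF X] by (simp add: top1_def)
  qed
qed

theorem proposition4p2:
  shows "\<exists>(n::nat) (p::nat) (L::real) (f::real mat \<Rightarrow> real)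
           (M::real measure) (C::real \<Rightarrow> real mat \<Rightarrow> real mat) (X0::real mat).
     1 \<le> p \<and> p \<le> n \<and>
     L_smooth n p L f \<and>
     contractive_compressor n p M C \<and>
     X0 \<in> carrier_mat n p \<and>
     (\<forall>lam>0. \<forall>\<gamma>>0. \<forall>\<omega>. (\<forall>k. \<omega> k \<in> space M) \<longrightarrow>
        (\<forall>k. iterate n p f C \<omega> lam \<gamma> X0 k = X0) \<and> \<not> stationary n p f X0)"
proof -
  define G :: "real mat" where "G = mat 2 1 (\<lambda>(i, j). if i = 0 then 2 else 1)"
  define X0 :: "real mat" where "X0 = mat 2 1 (\<lambda>(i, j). if i = 0 then 1 else 0)"
  have G: "G \<in> carrier_mat 2 1" and X0: "X0 \<in> carrier_mat 2 1"
    by (simp_all add: G_def X0_def)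
  have grad: "gradient 2 1 (fro_inner G) X0 = G"
    using G X0 by (rule gradient_fro_inner)
  have orth: "X0\<^sup>T * X0 = 1\<^sub>m 1"
    by (rule eq_matI) (auto simp: X0_def scalar_prod_def numeral_2_eq_2)
  have top1_G: "top1 G = 2 \<cdot>\<^sub>m X0"
    by (rule eq_matI) (auto simp: top1_def G_def X0_def)
  \<comment> \<open>The compressor is deterministic, so a point mass serves as its probability
    space.\<close>
  have "contractive_compressor 2 1 (return borel 0) (\<lambda>_. top1)"
    by (rule contractive_compressor_deterministic[where \<alpha> = "1/2"])
      (use top1_contraction in \<open>auto simp: top1_def prob_space_return\<close>)
  moreover have "iterate 2 1 (fro_inner G) (\<lambda>_. top1) \<omega> lam \<gamma> X0 k = X0"
    for \<omega> :: "nat \<Rightarrow> real" and lam \<gamma> k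
    using X0 by (rule iterate_eq_initial) (simp only: grad top1_G landing_field_smult_self[OF X0 orth])
  moreover have "\<not> stationary 2 1 (fro_inner G) X0"
  proof
    assume "stationary 2 1 (fro_inner G) X0"
    \<comment> \<open>The skew part has off-diagonal entries -1/2 and 1/2, so its product with
      \<open>X0\<close> is (0, 1/2); the second entry gives the contradiction.\<close>
    then have "(skew (G * X0\<^sup>T) * X0) $$ (1, 0) = 0"
      unfolding stationary_def grad by simp
    then show False
      by (simp add: skew_def G_def X0_def scalar_prod_def numeral_2_eq_2)
  qed
  ultimately show ?thesis
    using L_smooth_fro_inner[OF G] X0
    by (intro exI[of _ 2] exI[of _ 1] exI[of _ 0] exI[of _ "fro_inner G"]
        exI[of _ "return borel 0"] exI[of _ "\<lambda>_. top1"] exI[of _ X0]) auto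
qed

end
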